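(* Let $n,m\ge1$. The set $\mathsf{TN}^{\mathrm{trop}}(\mathbb{R})$ of $n\times m$ real tropical totally nonnegative matrices, thought of as a subset of $\mathbb{R}^{n\times m}$, is a polyhedron which can be written as the Minkowski sum $\mathsf{V}+\mathsf{S}$, where $$\mathsf{V}=\{(d_i+d'_j)_{i\in[n],\,j\in[m]}:\ d\in\mathbb{R}^n,\ d'\in\mathbb{R}^m\}$$ is the $(n+m-1)$-dimensional lineality space of this polyhedron, and $\mathsf{S}$ is the set of staircase matrices, which is a simplicial cone of dimension $(n-1)(m-1)$ with extreme rays generated by the elementary staircase matrices $L^{(i,j)}$, for $(i,j)\in([n]\setminus\{1\})\times([m]\setminus\{1\})$.
   Context: $[n]=\{1,\dots,n\}$. For a $d\times d$ real matrix $M$, $\operatorname{per}(M)=\max_{\sigma\in S_d}\sum_iM_{i,\sigma(i)}$; the weight of $\sigma$ is $\sum_iM_{i,\sigma(i)}$. A tropical minor of a matrix is the tropical permanent of a square submatrix (rows and columns in natural order). For real matrices, a tropical minor is tropically nonnegative unless all permutations of maximum weight are odd; equivalently, either all maximum-weight permutations are even, or there are maximum-weight permutations of both parities. $\mathsf{TN}^{\mathrm{trop}}(\mathbb{R})$ is the set of $n\times m$ matrices with entries in $\mathbb{R}$ all of whose tropical minors are tropically nonnegative. For $(i,j)\in([n]\setminus\{1\})\times([m]\setminus\{1\})$, the elementary staircase matrix $L^{(i,j)}\in\mathbb{R}^{n\times m}$ has $(t,s)$ entry $1$ if $t\ge i$ and $s\ge j$, and $0$ otherwise. A staircase matrix is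 a nonnegative linear combination of elementary staircase matrices. The lineality space of a polyhedron $P$ is the set of vectors $v$ with $P+\mathbb{R}v\subset P$. *)

theory Defs
  imports "HOL-Analysis.Analysis"
begin

text \<open>
  An \<open>n \<times> m\<close> real matrix is an element of \<^typ>\<open>real^'m^'n\<close>, where \<open>'n\<close> and \<open>'m\<close> are finite
  linearly ordered types with \<open>n\<close> and \<open>m\<close> elements. The order-isomorphism with
  \<open>{1, \<dots>, n}\<close> sends \<open>Min UNIV\<close> to \<open>1\<close>. A \<open>d \<times> d\<close> matrix whose size \<open>d\<close> is not fixed by a
  type is a function \<^typ>\<open>nat \<Rightarrow> nat \<Rightarrow> real\<close>, of which only the entries with
  indices in \<open>{..<d}\<close> are relevant.
\<close>

definition perm_weight :: "nat \<Rightarrow> (nat \<Rightarrow> nat \<Rightarrow> real) \<Rightarrow> (nat \<Rightarrow> nat) \<Rightarrow> real" where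
  "perm_weight d M \<sigma> = (\<Sum>i<d. M i (\<sigma> i))"

definition tropical_per :: "nat \<Rightarrow> (nat \<Rightarrow> nat \<Rightarrow> real) \<Rightarrow> real" where
  "tropical_per d M = Max {perm_weight d M \<sigma> | \<sigma>. \<sigma> permutes {..<d}}"

definition max_weight_perms :: "nat \<Rightarrow> (nat \<Rightarrow> nat \<Rightarrow> real) \<Rightarrow> (nat \<Rightarrow> nat) set" where
  "max_weight_perms d M = {\<sigma>. \<sigma> permutes {..<d} \<and> perm_weight d M \<sigma> = tropical_per d M}"

definition tropically_nonneg :: "nat \<Rightarrow> (nat \<Rightarrow> nat \<Rightarrow> real) \<Rightarrow> bool" where
  "tropically_nonneg d M \<longleftrightarrow> \<not> (\<forall>\<sigma>\<in>max_weight_perms d M. \<not> evenperm \<sigma>)"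

definition submatrix_of ::
  "real^'m::{finite,linorder}^'n::{finite,linorder} \<Rightarrow> 'n set \<Rightarrow> 'm set \<Rightarrow> nat \<Rightarrow> nat \<Rightarrow> real" where
  "submatrix_of A I J a b = A $ (sorted_list_of_set I ! a) $ (sorted_list_of_set J ! b)"

definition TN_trop :: "(real^'m::{finite,linorder}^'n::{finite,linorder}) set" where
  "TN_trop = {A. \<forall>I J. I \<noteq> {} \<and> card I = card J \<longrightarrow>
                   tropically_nonneg (card I) (submatrix_of A I J)}"

definition row_col_sums :: "(real^'m::finite^'n::finite) set" where
  "row_col_sums = {(\<chi> i j. d $ i + d' $ j) | (d :: real^'n::_) (d' :: real^'m::_). True}"

definition staircase_idx :: "('n::{finite,linorder} \<times> 'm::{finite,linorder}) set" where
  "staircase_idx = (UNIV - {Min UNIV}) \<times> (UNIV - {Min UNIV})"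

definition elem_staircase ::
  "'n::{finite,linorder} \<times> 'm::{finite,linorder} \<Rightarrow> real^'m::_^'n::_" where
  "elem_staircase p = (\<chi> t s. if fst p \<le> t \<and> snd p \<le> s then 1 else 0)"

definition staircase_matrices :: "(real^'m::{finite,linorder}^'n::{finite,linorder}) set" where
  "staircase_matrices =
     {(\<Sum>p\<in>staircase_idx. c p *\<^sub>R elem_staircase p) | c. \<forall>p\<in>staircase_idx. 0 \<le> c p}"

definition lineality_space :: "'a::real_vector set \<Rightarrow> 'a set" where
  "lineality_space P = {v. P + range (\<lambda>t::real. t *\<^sub>R v) \<subseteq> P}"

text \<open>The convex conic hull of the empty set is \<open>{0}\<close>, so \<open>{0}\<close> is a simplicial cone.\<close>

definition simplicial_cone :: "'a::real_vector set \<Rightarrow> bool" where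
  "simplicial_cone C \<longleftrightarrow> (\<exists>B. finite B \<and> independent B \<and> C = convex_cone hull B)"

definition extreme_rays :: "'a::real_vector set \<Rightarrow> 'a set set" where
  "extreme_rays C = {R. R face_of C \<and> (\<exists>v. v \<noteq> 0 \<and> R = conic hull {v})}"

end

theory Submission
  imports Defs
begin

text \<open>
  Write \<open>\<delta>\<^sub>i\<^sub>j(A) = A\<^sub>i\<^sub>j - A\<^sub>i\<^sub>,\<^sub>j\<^sub>-\<^sub>1 - A\<^sub>i\<^sub>-\<^sub>1\<^sub>,\<^sub>j + A\<^sub>i\<^sub>-\<^sub>1\<^sub>,\<^sub>j\<^sub>-\<^sub>1\<close> for \<open>i, j \<noteq> 1\<close>. Tropical
  nonnegativity of the \<open>2 \<times> 2\<close> minor on two consecutive rows and two consecutive columns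
  says exactly that \<open>\<delta>\<^sub>i\<^sub>j(A) \<ge> 0\<close>, so totally nonnegative matrices satisfy all these linear
  inequalities. They put a matrix into \<open>V + S\<close>, because the \<open>\<delta>\<^sub>i\<^sub>j\<close> are dual to the elementary staircase matrices:
  \<open>\<delta>\<^sub>p(L\<^sup>q)\<close> is \<open>1\<close> if \<open>p = q\<close> and \<open>0\<close> otherwise. By telescoping in both directions
  (\<open>proj_staircase_nth\<close>), subtracting \<open>\<Sum>\<^sub>p \<delta>\<^sub>p(A) L\<^sup>p\<close> from \<open>A\<close> leaves a matrix of the form
  \<open>d\<^sub>i + d'\<^sub>j\<close>. Hence \<open>V + S\<close> is the solution set of the inequalities.

  Conversely, in every square submatrix of a matrix in \<open>V + S\<close> the identity, which is even,
  has maximum weight (\<open>row_col_sums_plus_staircase_subset_TN\<close>). A summand in \<open>V\<close> gives all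
  permutations the same weight. A summand \<open>L\<^sup>p\<close> gives \<open>\<sigma>\<close> the weight \<open>|{a \<in> X. \<sigma>(a) \<in> Y}|\<close>
  for two up-closed sets \<open>X, Y\<close> of positions; these are nested, so this is at most
  \<open>min |X| |Y| = |X \<inter> Y|\<close>, the weight of the identity.

  All other claims are formal consequences of the duality and hold for every finite family of
  vectors with a dual family of linear functionals: the locale \<open>biorthogonal\<close> derives the
  half-space description, lineality space, dimensions and extreme rays once and for all.
\<close>

section \<open>Simplicial cones with a dual family of functionals\<close>

locale biorthogonal =
  fixes I :: "'i set" and b :: "'i \<Rightarrow> 'a::euclidean_space" and f :: "'i \<Rightarrow> 'a \<Rightarrow> real"
  assumes finite_index: "finite I"
    and linear_dual: "p \<in> I \<Longrightarrow> linear (f p)"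
    and dual: "p \<in> I \<Longrightarrow> q \<in> I \<Longrightarrow> f p (b q) = (if p = q then 1 else 0)"
begin

definition gen_cone :: "'a set" where
  "gen_cone = {(\<Sum>p\<in>I. c p *\<^sub>R b p) | c. \<forall>p\<in>I. 0 \<le> c p}"

text \<open>
  A complement of the span of the generators: the part of the space that the functionals do not
  see. Adding it to the cone turns the dual inequalities into a complete description.
\<close>

definition common_kernel :: "'a set" where
  "common_kernel = {x. \<forall>p\<in>I. f p x = 0}"

text \<open>The projection onto the span of the generators along \<^term>\<open>common_kernel\<close>.\<close>

definition proj :: "'a \<Rightarrow> 'a" where
  "proj x = (\<Sum>p\<in>I. f p x *\<^sub>R b p)"

lemma dual_combination:
  assumes "p \<in> I"
  shows "f p (\<Sum>q\<in>I. c q *\<^sub>R b q) = c p"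
proof -
  have "f p (\<Sum>q\<in>I. c q *\<^sub>R b q) = (\<Sum>q\<in>I. c q * f p (b q))"
    using linear_dual[OF assms] by (simp add: linear_sum linear_cmul)
  also have "\<dots> = (\<Sum>q\<in>I. if q = p then c q else 0)"
    using assms by (intro sum.cong) (auto simp: dual)
  also have "\<dots> = c p"
    using assms finite_index by simp
  finally show ?thesis .
qed

text \<open>
  The functionals read off the coefficients, so a vector of the span lies in the cone precisely
  when its dual coordinates are nonnegative. This coordinate description replaces the existential
  one in all that follows.
\<close>

lemma gen_cone_iff: "x \<in> gen_cone \<longleftrightarrow> (\<forall>p\<in>I. 0 \<le> f p x) \<and> proj x = x"
proof
  assume "x \<in> gen_cone"
  then obtain c where c: "x = (\<Sum>p\<in>I. c p *\<^sub>R b p)" "\<forall>p\<in>I. 0 \<le> c p"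
    by (auto simp: gen_cone_def)
  have "f p x = c p" if "p \<in> I" for p
    using dual_combination[OF that] c(1) by simp
  with c show "(\<forall>p\<in>I. 0 \<le> f p x) \<and> proj x = x"
    by (simp add: proj_def)
next
  assume a: "(\<forall>p\<in>I. 0 \<le> f p x) \<and> proj x = x"
  then have "x = (\<Sum>p\<in>I. f p x *\<^sub>R b p)" by (simp add: proj_def)
  with a show "x \<in> gen_cone"
    unfolding gen_cone_def by (auto intro!: exI[of _ "\<lambda>p. f p x"])
qed

lemma dual_proj: "p \<in> I \<Longrightarrow> f p (proj x) = f p x"
  unfolding proj_def by (rule dual_combination)

lemma linear_proj: "linear proj"
proof (rule linearI)
  fix x y show "proj (x + y) = proj x + proj y"
    by (simp add: proj_def linear_dual linear_add scaleR_add_left sum.distrib)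
next
  fix c :: real and x show "proj (c *\<^sub>R x) = c *\<^sub>R proj x"
    by (simp add: proj_def linear_dual linear_cmul scaleR_right.sum)
qed

lemma convex_cone_gen_cone: "convex_cone gen_cone"
  unfolding convex_cone_iff
proof (intro conjI ballI allI impI)
  show "0 \<in> gen_cone"
    by (simp add: gen_cone_iff linear_dual linear_0 linear_proj)
next
  fix x y assume "x \<in> gen_cone" "y \<in> gen_cone"
  then show "x + y \<in> gen_cone"
    by (simp add: gen_cone_iff linear_dual linear_add linear_proj)
next
  fix x and c :: real assume "x \<in> gen_cone" "0 \<le> c"
  then show "c *\<^sub>R x \<in> gen_cone"
    by (simp add: gen_cone_iff linear_dual linear_cmul linear_proj)
qed

lemma proj_generator: "p \<in> I \<Longrightarrow> proj (b p) = b p"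
proof -
  assume p: "p \<in> I"
  have "proj (b p) = (\<Sum>q\<in>I. if q = p then b q else 0)"
    unfolding proj_def using p by (intro sum.cong) (auto simp: dual)
  then show ?thesis using p finite_index by simp
qed

lemma generator_in_gen_cone: "p \<in> I \<Longrightarrow> b p \<in> gen_cone"
  by (auto simp: gen_cone_iff dual proj_generator)

lemma gen_cone_eq_hull: "gen_cone = convex_cone hull (b ` I)"
proof
  show "convex_cone hull (b ` I) \<subseteq> gen_cone"
    by (rule hull_minimal) (auto simp: generator_in_gen_cone convex_cone_gen_cone)
  have "(\<Sum>p\<in>J. c p *\<^sub>R b p) \<in> convex_cone hull (b ` I)"
    if "finite J" "J \<subseteq> I" "\<forall>p\<in>I. 0 \<le> c p" for J c
    using that
  proof (induction J rule: finite_induct)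
    case empty
    show ?case by (simp add: convex_cone_hull_contains_0)
  next
    case (insert q F)
    have "b q \<in> convex_cone hull (b ` I)"
      using insert.prems(1) by (intro hull_inc) auto
    with insert show ?case
      by (auto intro!: convex_cone_hull_add intro: convex_cone_hull_mul)
  qed
  then show "gen_cone \<subseteq> convex_cone hull (b ` I)"
    unfolding gen_cone_def using finite_index by blast
qed

lemma inj_on_generator: "inj_on b I"
proof (rule inj_onI)
  fix p q assume "p \<in> I" "q \<in> I" "b p = b q"
  then show "p = q" using dual[of p p] dual[of p q] by (auto split: if_splits)
qed

text \<open>Applying the dual functional of \<open>b p\<close> to a linear relation isolates the coefficient of \<open>b p\<close>.\<close>

lemma independent_generators: "independent (b ` I)"
proof -
  have "u v = 0" if zero: "(\<Sum>v\<in>b ` I. u v *\<^sub>R v) = 0" and v: "v \<in> b ` I" for u v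
  proof -
    obtain p where p: "p \<in> I" "v = b p" using v by blast
    have "(\<Sum>q\<in>I. u (b q) *\<^sub>R b q) = 0"
      using zero by (simp add: sum.reindex[OF inj_on_generator])
    then show ?thesis
      using dual_combination[OF p(1), of "u \<circ> b"] linear_0[OF linear_dual[OF p(1)]] p(2) by simp
  qed
  then show ?thesis
    using finite_index by (auto simp: independent_explicit)
qed

lemma simplicial_cone_gen_cone: "simplicial_cone gen_cone"
  unfolding simplicial_cone_def
  using finite_index independent_generators gen_cone_eq_hull by blast

lemma span_gen_cone: "span gen_cone = span (b ` I)"
proof
  have "b ` I \<subseteq> gen_cone"
    using generator_in_gen_cone by blast
  then show "span (b ` I) \<subseteq> span gen_cone"
    by (rule span_mono)
  have "gen_cone \<subseteq> span (b ` I)"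
    unfolding gen_cone_eq_hull
    by (rule hull_minimal) (auto intro: span_base convex_cone_span)
  then show "span gen_cone \<subseteq> span (b ` I)"
    by (simp add: span_minimal)
qed

lemma dim_span_generators: "dim (span (b ` I)) = card I"
  using independent_generators card_image[OF inj_on_generator] by (simp add: dim_span dim_eq_card_independent)

lemma aff_dim_gen_cone: "aff_dim gen_cone = int (card I)"
proof -
  have "aff_dim gen_cone = int (dim gen_cone)"
    using convex_cone_contains_0[OF convex_cone_gen_cone] by (intro aff_dim_zero hull_inc)
  also have "dim gen_cone = card I"
    using dim_span_generators span_gen_cone dim_span by metis
  finally show ?thesis .
qed

text \<open>
  The ray of \<open>b p\<close> is the part of the cone where all other dual coordinates vanish. These
  coordinates are nonnegative on the cone, so one that vanishes strictly between two points of the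
  cone vanishes at both of them.
\<close>

lemma ray_face:
  assumes p: "p \<in> I"
  shows "conic hull {b p} face_of gen_cone"
  unfolding face_of_def
proof (intro conjI ballI impI)
  show "conic hull {b p} \<subseteq> gen_cone"
  proof (rule hull_minimal)
    show "{b p} \<subseteq> gen_cone"
      using generator_in_gen_cone[OF p] by simp
    show "conic gen_cone"
      using convex_cone_gen_cone by (simp add: convex_cone_def)
  qed
  show "convex (conic hull {b p})"
    by (simp add: convex_conic_hull)
  fix x y z
  assume x: "x \<in> gen_cone" and y: "y \<in> gen_cone" and z: "z \<in> conic hull {b p}"
    and seg: "z \<in> open_segment x y"
  obtain u where u: "0 < u" "u < 1" "z = (1 - u) *\<^sub>R x + u *\<^sub>R y"
    using seg by (auto simp: in_segment)
  obtain t where t: "z = t *\<^sub>R b p"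
    using z by (auto simp: conic_hull_explicit)
  have zero: "f q x = 0 \<and> f q y = 0" if q: "q \<in> I" "q \<noteq> p" for q
  proof -
    have "f q z = 0"
      using t q p by (simp add: linear_dual linear_cmul dual)
    then have "(1 - u) * f q x + u * f q y = 0"
      using u(3) q by (simp add: linear_dual linear_add linear_cmul)
    moreover have "0 \<le> f q x" "0 \<le> f q y"
      using x y q by (auto simp: gen_cone_iff)
    ultimately show ?thesis
      using u(1,2) by (simp add: add_nonneg_eq_0_iff)
  qed
  have ray: "w \<in> conic hull {b p}" if w: "w \<in> gen_cone" "\<And>q. q \<in> I \<Longrightarrow> q \<noteq> p \<Longrightarrow> f q w = 0" for w
  proof -
    have "proj w = (\<Sum>q\<in>I. if q = p then f p w *\<^sub>R b p else 0)"
      unfolding proj_def using w(2) by (intro sum.cong) auto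
    then have "w = f p w *\<^sub>R b p"
      using w(1) p finite_index by (simp add: gen_cone_iff)
    moreover have "0 \<le> f p w"
      using w(1) p by (simp add: gen_cone_iff)
    ultimately show ?thesis
      by (auto simp: conic_hull_explicit)
  qed
  show "x \<in> conic hull {b p}" "y \<in> conic hull {b p}"
    using ray x y zero by blast+
qed

text \<open>
  If \<open>s\<close>, the coordinate of \<open>v\<close> at \<open>p\<close>, is positive, then \<open>v\<close> is the midpoint of
  \<open>2s b\<^sub>p\<close> and \<open>2(v - s b\<^sub>p)\<close>, both in the cone. When the ray of \<open>v\<close> is a face, it therefore
  contains \<open>b\<^sub>p\<close>.
\<close>

lemma ray_face_is_generated:
  assumes face: "conic hull {v} face_of gen_cone" and v: "v \<noteq> 0"
  obtains p where "p \<in> I" "conic hull {v} = conic hull {b p}"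
proof -
  have vR: "v \<in> conic hull {v}" by (simp add: hull_inc)
  have vC: "v \<in> gen_cone" using face vR by (auto simp: face_of_def)
  have "\<exists>p\<in>I. f p v \<noteq> 0"
  proof (rule ccontr)
    assume "\<not> ?thesis"
    then have "proj v = 0" by (simp add: proj_def)
    with v vC show False by (simp add: gen_cone_iff)
  qed
  then obtain p where p: "p \<in> I" "f p v \<noteq> 0" by blast
  define s where "s = f p v"
  have s: "0 < s" using p vC by (auto simp: s_def gen_cone_iff less_le)
  define x where "x = (2 * s) *\<^sub>R b p"
  define y where "y = 2 *\<^sub>R (v - s *\<^sub>R b p)"
  have mid: "v = (1 - 1/2) *\<^sub>R x + (1/2::real) *\<^sub>R y"
    by (simp add: x_def y_def scaleR_diff_right)
  have xC: "x \<in> gen_cone"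
    using s generator_in_gen_cone[OF p(1)] convex_cone_scaleR[OF convex_cone_gen_cone]
    by (simp add: x_def)
  have "v - s *\<^sub>R b p \<in> gen_cone"
    using vC p(1)
    by (simp add: gen_cone_iff linear_dual linear_diff linear_cmul dual linear_proj proj_generator s_def)
  then have yC: "y \<in> gen_cone"
    using convex_cone_scaleR[OF convex_cone_gen_cone] by (simp add: y_def)
  have "x \<in> conic hull {v}"
  proof (cases "x = y")
    case True
    then have "x = v" using mid by (simp flip: scaleR_add_left)
    then show ?thesis using vR by simp
  next
    case False
    then have "v \<in> open_segment x y"
      using mid unfolding in_segment by (auto intro!: exI[of _ "1/2"])
    then show ?thesis
      using face xC yC vR unfolding face_of_def by blast
  qed
  then obtain t where t: "0 \<le> t" "x = t *\<^sub>R v"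
    by (auto simp: conic_hull_explicit)
  have "b p \<noteq> 0"
    using dual[OF p(1) p(1)] linear_0[OF linear_dual[OF p(1)]] by auto
  with s t have tpos: "0 < t" by (auto simp: x_def less_le)
  have bp: "b p = (t / (2 * s)) *\<^sub>R v"
  proof -
    have "b p = (1 / (2 * s)) *\<^sub>R x" using s by (simp add: x_def)
    then show ?thesis using t by simp
  qed
  have "conic hull {b p} = conic hull {v}"
    using conic_hull_image_scale[of "{v}" "\<lambda>_. t / (2 * s)"] s tpos by (simp add: bp)
  with p(1) show ?thesis using that by simp
qed

lemma extreme_rays_gen_cone: "extreme_rays gen_cone = (\<lambda>p. conic hull {b p}) ` I"
proof -
  have "b p \<noteq> 0" if "p \<in> I" for p
    using dual[OF that that] linear_0[OF linear_dual[OF that]] by auto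
  then show ?thesis
    unfolding extreme_rays_def using ray_face
    by (auto elim: ray_face_is_generated)
qed

lemma diff_proj_in_kernel: "x - proj x \<in> common_kernel"
  by (auto simp: common_kernel_def linear_dual linear_diff dual_proj)

text \<open>
  The decomposition of \<open>x\<close> is \<open>(x - proj x) + proj x\<close>; the projection does not change the dual
  coordinates, so their signs alone decide membership.
\<close>

lemma kernel_plus_gen_cone: "common_kernel + gen_cone = {x. \<forall>p\<in>I. 0 \<le> f p x}"
proof (intro equalityI subsetI)
  fix x assume "x \<in> common_kernel + gen_cone"
  then show "x \<in> {x. \<forall>p\<in>I. 0 \<le> f p x}"
    by (auto simp: set_plus_def common_kernel_def gen_cone_iff linear_dual linear_add)
next
  fix x assume x: "x \<in> {x. \<forall>p\<in>I. 0 \<le> f p x}"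
  then have "proj x \<in> gen_cone" by (auto simp: gen_cone_def proj_def)
  with diff_proj_in_kernel[of x] have "(x - proj x) + proj x \<in> common_kernel + gen_cone"
    by (rule set_plus_intro)
  then show "x \<in> common_kernel + gen_cone" by simp
qed

text \<open>Each dual functional is the inner product with a fixed vector, so each inequality cuts out a half-space.\<close>

lemma polyhedron_kernel_plus_gen_cone: "polyhedron (common_kernel + gen_cone)"
proof -
  have "f p x = adjoint (f p) 1 \<bullet> x" if "p \<in> I" for p x
    using adjoint_works[OF linear_dual[OF that], of x 1] by (simp add: inner_commute)
  then have "common_kernel + gen_cone = \<Inter> ((\<lambda>p. {x. adjoint (f p) 1 \<bullet> x \<ge> 0}) ` I)"
    by (auto simp: kernel_plus_gen_cone)
  then show ?thesis
    using finite_index by (auto intro!: polyhedron_Inter polyhedron_halfspace_ge)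
qed

lemma subspace_kernel: "subspace common_kernel"
  by (auto simp: subspace_def common_kernel_def linear_dual linear_0 linear_add linear_cmul)

text \<open>
  The set is invariant along \<open>v\<close> only if it contains both \<open>v\<close> and \<open>-v\<close>, which forces the dual
  coordinates of \<open>v\<close> to vanish.
\<close>

lemma lineality_space_kernel_plus_gen_cone: "lineality_space (common_kernel + gen_cone) = common_kernel"
proof (intro equalityI subsetI)
  fix v assume "v \<in> lineality_space (common_kernel + gen_cone)"
  then have sub: "(common_kernel + gen_cone) + range (\<lambda>t::real. t *\<^sub>R v) \<subseteq> common_kernel + gen_cone"
    by (simp add: lineality_space_def)
  have "0 \<in> common_kernel + gen_cone"
    by (auto simp: kernel_plus_gen_cone linear_dual linear_0)
  then have "0 + t *\<^sub>R v \<in> (common_kernel + gen_cone) + range (\<lambda>t::real. t *\<^sub>R v)" for t :: real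
    by (intro set_plus_intro) auto
  then have mem: "t *\<^sub>R v \<in> common_kernel + gen_cone" for t :: real
    using sub by auto
  show "v \<in> common_kernel"
    using mem[of 1] mem[of "-1"] unfolding kernel_plus_gen_cone
    by (auto simp: common_kernel_def linear_dual linear_neg intro: antisym)
next
  fix v assume "v \<in> common_kernel"
  then show "v \<in> lineality_space (common_kernel + gen_cone)"
    unfolding lineality_space_def kernel_plus_gen_cone
    by (auto simp: common_kernel_def linear_dual linear_add linear_cmul elim!: set_plus_elim)
qed

text \<open>The whole space is the direct sum of the common kernel and the span of the generators.\<close>

lemma dim_kernel: "dim common_kernel + card I = DIM('a)"
proof -
  let ?U = "span (b ` I)"
  have rep: "proj x \<in> ?U" for x
    unfolding proj_def by (intro span_sum span_scale span_base) auto
  have fix_proj: "proj x = x" if "x \<in> ?U" for x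
    using that
  proof (rule span_induct_alt)
    show "proj 0 = 0" by (simp add: linear_0 linear_proj)
  next
    fix c v y assume "v \<in> b ` I" "proj y = y"
    then obtain p where p: "p \<in> I" "v = b p" by blast
    have "proj (c *\<^sub>R v + y) = c *\<^sub>R proj v + proj y"
      by (simp add: linear_add linear_cmul linear_proj)
    then show "proj (c *\<^sub>R v + y) = c *\<^sub>R v + y"
      using p \<open>proj y = y\<close> by (simp add: proj_generator)
  qed
  have "common_kernel \<inter> ?U = {0}"
  proof -
    have "x = 0" if "x \<in> common_kernel" "x \<in> ?U" for x
      using fix_proj[OF that(2)] that(1) by (simp add: proj_def common_kernel_def)
    then show ?thesis using subspace_0[OF subspace_kernel] span_0 by blast
  qed
  moreover have "{x + y |x y. x \<in> common_kernel \<and> y \<in> ?U} = UNIV"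
  proof -
    have "x \<in> {x + y |x y. x \<in> common_kernel \<and> y \<in> ?U}" for x
      using diff_proj_in_kernel[of x] rep[of x]
      by (intro CollectI exI[of _ "x - proj x"] exI[of _ "proj x"]) auto
    then show ?thesis by blast
  qed
  ultimately show ?thesis
    using dim_sums_Int[OF subspace_kernel subspace_span[of "b ` I"]] dim_span_generators by simp
qed

end

section \<open>Mixed differences of a matrix\<close>

text \<open>The immediate predecessor of \<open>i\<close>; a genuine one only if \<open>i\<close> is not the least index.\<close>

definition pred_index :: "'a::{finite,linorder} \<Rightarrow> 'a" where
  "pred_index i = Max {k. k < i}"

lemma pred_index_less:
  fixes i :: "'a::{finite,linorder}"
  assumes "i \<noteq> Min UNIV"
  shows "pred_index i < i"
proof -
  have "Min UNIV < i" using assms by (simp add: less_le)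
  then have "{k. k < i} \<noteq> {}" by blast
  then have "Max {k. k < i} \<in> {k. k < i}" by (intro Max_in) auto
  then show ?thesis by (simp add: pred_index_def)
qed

lemma less_iff_le_pred_index:
  fixes i :: "'a::{finite,linorder}"
  assumes "i \<noteq> Min UNIV"
  shows "k < i \<longleftrightarrow> k \<le> pred_index i"
  using pred_index_less[OF assms] by (auto simp: pred_index_def)

text \<open>
  Telescoping along a finite linear order. The range \<open>i \<le> t\<close> is expressed by a conditional
  because that is how the entries of elementary staircase matrices present it.
\<close>

lemma sum_pred_differences:
  fixes g :: "'a::{finite,linorder} \<Rightarrow> real"
  shows "(\<Sum>i\<in>UNIV - {Min UNIV}. if i \<le> t then g i - g (pred_index i) else 0) = g t - g (Min UNIV)"
proof (induction "card {k. k < t}" arbitrary: t rule: less_induct)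
  case less
  let ?d = "\<lambda>i. g i - g (pred_index i)"
  show ?case
  proof (cases "t = Min UNIV")
    case True
    then have "\<not> i \<le> t" if "i \<in> UNIV - {Min UNIV}" for i
      using that True by (metis Diff_iff Min_le UNIV_I antisym finite insertI1)
    then have "(\<Sum>i\<in>UNIV - {Min UNIV}. if i \<le> t then ?d i else 0) = 0"
      by (intro sum.neutral) simp
    then show ?thesis using True by simp
  next
    case False
    let ?s = "pred_index t"
    have "{k. k < ?s} \<subset> {k. k < t}"
      using pred_index_less[OF False] by auto
    then have "card {k. k < ?s} < card {k. k < t}"
      by (intro psubset_card_mono) auto
    note IH = less[OF this]
    have "(\<Sum>i\<in>UNIV - {Min UNIV}. if i \<le> t then ?d i else 0)
        = (\<Sum>i\<in>UNIV - {Min UNIV}. (if i \<le> ?s then ?d i else 0) + (if i = t then ?d t else 0))"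
      using less_iff_le_pred_index[OF False] pred_index_less[OF False]
      by (intro sum.cong) (auto simp: le_less)
    also have "\<dots> = g ?s - g (Min UNIV) + ?d t"
      using IH False by (simp add: sum.distrib)
    finally show ?thesis by simp
  qed
qed

definition mixed_diff ::
  "'n::{finite,linorder} \<times> 'm::{finite,linorder} \<Rightarrow> real^'m::_^'n::_ \<Rightarrow> real" where
  "mixed_diff p A =
     (A $ fst p $ snd p - A $ fst p $ pred_index (snd p))
     - (A $ pred_index (fst p) $ snd p - A $ pred_index (fst p) $ pred_index (snd p))"

lemma linear_mixed_diff: "linear (mixed_diff p)"
  by (rule linearI) (simp_all add: mixed_diff_def algebra_simps)

text \<open>
  An elementary staircase matrix is the product of two step functions, each of which jumps
  only at the corner index of its coordinate.
\<close>

lemma mixed_diff_elem_staircase: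
  assumes "p \<in> staircase_idx" "q \<in> staircase_idx"
  shows "mixed_diff p (elem_staircase q) = (if p = q then 1 else 0)"
proof -
  obtain i j k l where pq: "p = (i, j)" "q = (k, l)" by (cases p, cases q)
  then have i: "i \<noteq> Min UNIV" and j: "j \<noteq> Min UNIV"
    using assms by (auto simp: staircase_idx_def)
  show ?thesis
    using less_iff_le_pred_index[OF i, of k] less_iff_le_pred_index[OF j, of l]
    unfolding pq mixed_diff_def elem_staircase_def by auto
qed

interpretation staircase: biorthogonal
  "staircase_idx :: ('n::{finite,linorder} \<times> 'm::{finite,linorder}) set" elem_staircase mixed_diff
  by (rule biorthogonal.intro) (simp_all only: finite linear_mixed_diff mixed_diff_elem_staircase)

lemma gen_cone_eq_staircase_matrices: "staircase.gen_cone = staircase_matrices"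
  by (simp add: staircase.gen_cone_def staircase_matrices_def)

text \<open>
  Summing the mixed differences over all \<open>(i, j) \<le> (t, s)\<close> telescopes in each of the two
  directions, leaving only values at \<open>(t, s)\<close> and in the first row and column.
\<close>

lemma proj_staircase_nth:
  fixes A :: "real^'m::{finite,linorder}^'n::{finite,linorder}"
  shows "staircase.proj A $ t $ s
    = A $ t $ s - A $ t $ Min UNIV - (A $ Min UNIV $ s - A $ Min UNIV $ Min UNIV)"
proof -
  let ?row = "\<lambda>j i. A $ i $ j - A $ i $ pred_index j"
  have "staircase.proj A $ t $ s
      = (\<Sum>p\<in>staircase_idx. mixed_diff p A * (if fst p \<le> t \<and> snd p \<le> s then 1 else 0))"
    by (simp add: staircase.proj_def elem_staircase_def)
  also have "\<dots> = (\<Sum>i\<in>UNIV - {Min UNIV}. \<Sum>j\<in>UNIV - {Min UNIV}.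
        mixed_diff (i, j) A * (if i \<le> t \<and> j \<le> s then 1 else 0))"
    by (simp add: staircase_idx_def sum.cartesian_product case_prod_beta)
  also have "\<dots> = (\<Sum>j\<in>UNIV - {Min UNIV}. \<Sum>i\<in>UNIV - {Min UNIV}.
        mixed_diff (i, j) A * (if i \<le> t \<and> j \<le> s then 1 else 0))"
    by (rule sum.swap)
  also have "\<dots> = (\<Sum>j\<in>UNIV - {Min UNIV}. if j \<le> s then
        (\<Sum>i\<in>UNIV - {Min UNIV}. if i \<le> t then ?row j i - ?row j (pred_index i) else 0) else 0)"
    by (intro sum.cong refl) (simp add: mixed_diff_def if_distrib cong: if_cong)
  also have "\<dots> = (\<Sum>j\<in>UNIV - {Min UNIV}. if j \<le> s then
        (A $ t $ j - A $ Min UNIV $ j)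
        - (A $ t $ pred_index j - A $ Min UNIV $ pred_index j) else 0)"
    by (intro sum.cong refl if_cong, subst sum_pred_differences) simp
  also have "\<dots> = (A $ t $ s - A $ Min UNIV $ s) - (A $ t $ Min UNIV - A $ Min UNIV $ Min UNIV)"
    by (rule sum_pred_differences)
  finally show ?thesis by simp
qed

text \<open>
  If all mixed differences vanish, the telescoped sum is zero, and
  \<open>A\<^sub>t\<^sub>s = A\<^sub>t\<^sub>1 + (A\<^sub>1\<^sub>s - A\<^sub>1\<^sub>1)\<close> exhibits the row and column parts.
\<close>

lemma kernel_eq_row_col_sums:
  "staircase.common_kernel = (row_col_sums :: (real^'m::{finite,linorder}^'n::{finite,linorder}) set)"
proof (intro equalityI subsetI)
  fix A :: "real^'m::_^'n::_" assume "A \<in> staircase.common_kernel"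
  then have "staircase.proj A = 0"
    by (simp add: staircase.common_kernel_def staircase.proj_def)
  then have "A $ t $ s - A $ t $ Min UNIV - (A $ Min UNIV $ s - A $ Min UNIV $ Min UNIV) = 0" for t s
    using proj_staircase_nth[of A t s] by simp
  then have "A $ t $ s = A $ t $ Min UNIV + (A $ Min UNIV $ s - A $ Min UNIV $ Min UNIV)" for t s
    by (metis add.commute diff_add_cancel diff_eq_eq eq_iff_diff_eq_0)
  then have "A = (\<chi> i j. (\<chi> i. A $ i $ Min UNIV) $ i
      + (\<chi> j. A $ Min UNIV $ j - A $ Min UNIV $ Min UNIV) $ j)"
    unfolding vec_eq_iff vec_lambda_beta by blast
  then show "A \<in> row_col_sums" unfolding row_col_sums_def by blast
next
  fix A :: "real^'m::_^'n::_" assume "A \<in> row_col_sums"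
  then show "A \<in> staircase.common_kernel"
    by (auto simp: row_col_sums_def staircase.common_kernel_def mixed_diff_def)
qed

lemma card_staircase_idx:
  "card (staircase_idx :: ('n::{finite,linorder} \<times> 'm::{finite,linorder}) set)
    = (CARD('n) - 1) * (CARD('m) - 1)"
  by (simp add: staircase_idx_def card_cartesian_product card_Diff_singleton)

section \<open>Weights of permutations and total nonnegativity\<close>

lemma tropically_nonneg_if_id_maximal:
  assumes "\<And>\<sigma>. \<sigma> permutes {..<d} \<Longrightarrow> perm_weight d M \<sigma> \<le> perm_weight d M id"
  shows "tropically_nonneg d M"
proof -
  have "tropical_per d M = perm_weight d M id"
    unfolding tropical_per_def
  proof (rule Max_eqI)
    show "finite {perm_weight d M \<sigma> |\<sigma>. \<sigma> permutes {..<d}}"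
      using finite_permutations[of "{..<d}"] by (simp add: setcompr_eq_image)
  qed (use assms permutes_id in blast)+
  then have "id \<in> max_weight_perms d M"
    by (simp add: max_weight_perms_def permutes_id)
  then show ?thesis
    unfolding tropically_nonneg_def by (meson evenperm_id)
qed

text \<open>
  In size \<open>2\<close> the identity is the only even permutation, so it has to have maximum weight.
\<close>

lemma tropically_nonneg_2:
  assumes "tropically_nonneg 2 M"
  shows "M 0 1 + M 1 0 \<le> M 0 0 + M 1 1"
proof -
  have two: "{..<2::nat} = {0, 1}" by auto
  obtain \<sigma> where s: "\<sigma> permutes {..<2}" "evenperm \<sigma>" "perm_weight 2 M \<sigma> = tropical_per 2 M"
    using assms by (auto simp: tropically_nonneg_def max_weight_perms_def)
  have "\<sigma> = id"
    using s(1,2) unfolding two permutes_doubleton_iff by (auto simp: evenperm_swap)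
  have "perm_weight 2 M (Transposition.transpose 0 1) \<le> tropical_per 2 M"
    unfolding tropical_per_def
  proof (rule Max_ge)
    show "finite {perm_weight 2 M \<sigma> |\<sigma>. \<sigma> permutes {..<2}}"
      using finite_permutations[of "{..<2::nat}"] by (simp add: setcompr_eq_image)
    have "Transposition.transpose 0 1 permutes {..<2::nat}"
      by (rule permutes_swap_id) auto
    then show "perm_weight 2 M (Transposition.transpose 0 1) \<in> {perm_weight 2 M \<sigma> |\<sigma>. \<sigma> permutes {..<2}}"
      by blast
  qed
  then show ?thesis
    using s(3) \<open>\<sigma> = id\<close> by (simp add: perm_weight_def two)
qed

lemma perm_weight_linear: "linear (\<lambda>A. perm_weight d (submatrix_of A I J) \<sigma>)"
  by (rule linearI)
     (simp_all add: perm_weight_def submatrix_of_def sum.distrib sum_distrib_left)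

text \<open>A permutation selects each row and each column once, hence collects every \<open>d\<^sub>i\<close> and \<open>d'\<^sub>j\<close> once.\<close>

lemma perm_weight_row_col_sums:
  assumes "A \<in> row_col_sums" and "\<sigma> permutes {..<d}"
  shows "perm_weight d (submatrix_of A I J) \<sigma> = perm_weight d (submatrix_of A I J) id"
proof -
  obtain u v where A: "A = (\<chi> i j. u $ i + v $ j)"
    using assms(1) by (auto simp: row_col_sums_def)
  have "(\<Sum>a<d. v $ (sorted_list_of_set J ! \<sigma> a)) = (\<Sum>a<d. v $ (sorted_list_of_set J ! a))"
    using sum.permute[OF assms(2), of "\<lambda>a. v $ (sorted_list_of_set J ! a)"] by (simp add: o_def)
  then show ?thesis
    by (simp add: A perm_weight_def submatrix_of_def sum.distrib)
qed

text \<open>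
  Two up-closed subsets of \<open>{..<d}\<close> are nested. The left-hand side is bounded by the size of
  either set, since \<open>\<sigma>\<close> is injective, and the intersection is the smaller of the two.
\<close>

lemma card_permuted_upsets_le:
  fixes X Y :: "nat set"
  assumes \<sigma>: "\<sigma> permutes {..<d}"
    and X: "X \<subseteq> {..<d}" "\<And>a b. a \<in> X \<Longrightarrow> a \<le> b \<Longrightarrow> b < d \<Longrightarrow> b \<in> X"
    and Y: "Y \<subseteq> {..<d}" "\<And>a b. a \<in> Y \<Longrightarrow> a \<le> b \<Longrightarrow> b < d \<Longrightarrow> b \<in> Y"
  shows "card {a\<in>X. \<sigma> a \<in> Y} \<le> card (X \<inter> Y)"
proof -
  have fin: "finite X" "finite Y" using X(1) Y(1) finite_subset by auto
  have "X \<subseteq> Y \<or> Y \<subseteq> X"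
  proof (rule ccontr)
    assume "\<not> ?thesis"
    then obtain x y where "x \<in> X" "x \<notin> Y" "y \<in> Y" "y \<notin> X" by blast
    then show False using X Y by (metis lessThan_iff nle_le subsetD)
  qed
  then show ?thesis
  proof
    assume "X \<subseteq> Y"
    then have "X \<inter> Y = X" by blast
    then show ?thesis using fin by (auto intro: card_mono)
  next
    assume "Y \<subseteq> X"
    then have "X \<inter> Y = Y" by blast
    moreover have "card {a\<in>X. \<sigma> a \<in> Y} \<le> card Y"
      using permutes_inj[OF \<sigma>] fin by (intro card_inj_on_le[of \<sigma>]) (auto intro: inj_on_subset)
    ultimately show ?thesis by simp
  qed
qed

text \<open>
  The entry selected in row position \<open>a\<close> is \<open>1\<close> exactly if \<open>a\<close> and \<open>\<sigma> a\<close> lie in the sets of row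
  and column positions beyond the corner \<open>p\<close>, which are up-closed because rows and columns are
  listed in increasing order.
\<close>

lemma perm_weight_elem_staircase_le:
  assumes "\<sigma> permutes {..<d}" "card I = d" "card J = d"
  shows "perm_weight d (submatrix_of (elem_staircase p) I J) \<sigma>
    \<le> perm_weight d (submatrix_of (elem_staircase p) I J) id"
proof -
  define X where "X = {a. a < d \<and> fst p \<le> sorted_list_of_set I ! a}"
  define Y where "Y = {a. a < d \<and> snd p \<le> sorted_list_of_set J ! a}"
  have less: "\<tau> a < d" if "\<tau> permutes {..<d}" "a < d" for \<tau> a
    using that permutes_in_image by fastforce
  have weight: "perm_weight d (submatrix_of (elem_staircase p) I J) \<tau>
      = real (card {a\<in>X. \<tau> a \<in> Y})" if "\<tau> permutes {..<d}" for \<tau>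
  proof -
    have "perm_weight d (submatrix_of (elem_staircase p) I J) \<tau>
        = (\<Sum>a<d. if a \<in> {a\<in>X. \<tau> a \<in> Y} then 1 else 0)"
      unfolding perm_weight_def submatrix_of_def elem_staircase_def
      using less[OF that] by (intro sum.cong) (auto simp: X_def Y_def)
    also have "\<dots> = real (card ({..<d} \<inter> {a\<in>X. \<tau> a \<in> Y}))"
      by (simp add: sum.If_cases)
    also have "{..<d} \<inter> {a\<in>X. \<tau> a \<in> Y} = {a\<in>X. \<tau> a \<in> Y}"
      by (auto simp: X_def)
    finally show ?thesis .
  qed
  have "card {a\<in>X. \<sigma> a \<in> Y} \<le> card (X \<inter> Y)"
  proof (rule card_permuted_upsets_le[OF assms(1)])
    have mono: "sorted_list_of_set K ! a \<le> sorted_list_of_set K ! b"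
      if "a \<le> b" "b < card K" for a b and K :: "'c::{finite,linorder} set"
      using that by (intro sorted_nth_mono) auto
    show "b \<in> X" if "a \<in> X" "a \<le> b" "b < d" for a b
      using that mono[of a b I] assms(2) by (auto simp: X_def)
    show "b \<in> Y" if "a \<in> Y" "a \<le> b" "b < d" for a b
      using that mono[of a b J] assms(3) by (auto simp: Y_def)
  qed (auto simp: X_def Y_def)
  moreover have "X \<inter> Y = {a\<in>X. id a \<in> Y}" by auto
  ultimately show ?thesis
    using weight[OF assms(1)] weight[OF permutes_id] by simp
qed

text \<open>
  The weight is linear in the matrix, so maximality of the identity passes from the summands to
  their nonnegative combinations.
\<close>

lemma row_col_sums_plus_staircase_subset_TN:
  "row_col_sums + staircase_matrices \<subseteq>
     (TN_trop :: (real^'m::{finite,linorder}^'n::{finite,linorder}) set)"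
proof
  fix A :: "real^'m::_^'n::_" assume "A \<in> row_col_sums + staircase_matrices"
  then obtain B c where A: "A = B + (\<Sum>p\<in>staircase_idx. c p *\<^sub>R elem_staircase p)"
    and B: "B \<in> row_col_sums" and c: "\<forall>p\<in>staircase_idx. 0 \<le> c p"
    by (auto simp: set_plus_def staircase_matrices_def)
  show "A \<in> TN_trop"
    unfolding TN_trop_def
  proof (intro CollectI allI impI tropically_nonneg_if_id_maximal)
    fix I :: "'n set" and J :: "'m set" and \<sigma>
    assume IJ: "I \<noteq> {} \<and> card I = card J" and \<sigma>: "\<sigma> permutes {..<card I}"
    let ?w = "\<lambda>A \<tau>. perm_weight (card I) (submatrix_of A I J) \<tau>"
    have w: "?w A \<tau> = ?w B \<tau> + (\<Sum>p\<in>staircase_idx. c p * ?w (elem_staircase p) \<tau>)" for \<tau>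
    proof -
      note lin = perm_weight_linear[of "card I" I J \<tau>]
      show ?thesis
        by (simp add: A linear_add[OF lin] linear_sum[OF lin] linear_cmul[OF lin])
    qed
    show "?w A \<sigma> \<le> ?w A id"
      unfolding w
    proof (intro add_mono sum_mono mult_left_mono)
      show "?w B \<sigma> \<le> ?w B id"
        using perm_weight_row_col_sums[OF B \<sigma>] by simp
      fix p :: "'n \<times> 'm" assume "p \<in> staircase_idx"
      then show "0 \<le> c p"
        using c by blast
      show "?w (elem_staircase p) \<sigma> \<le> ?w (elem_staircase p) id"
        using IJ by (intro perm_weight_elem_staircase_le \<sigma>) auto
    qed
  qed
qed

text \<open>
  The mixed difference at \<open>(i, j)\<close> is the weight of the identity minus the weight of the
  transposition, in the submatrix on the rows \<open>i - 1, i\<close> and columns \<open>j - 1, j\<close>.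
\<close>

lemma mixed_diff_nonneg_if_TN:
  fixes A :: "real^'m::{finite,linorder}^'n::{finite,linorder}"
  assumes "A \<in> TN_trop" and "p \<in> staircase_idx"
  shows "0 \<le> mixed_diff p A"
proof -
  obtain i j where p: "p = (i, j)" by (cases p)
  with assms(2) have ij: "pred_index i < i" "pred_index j < j"
    by (auto simp: staircase_idx_def intro: pred_index_less)
  let ?I = "{pred_index i, i}" and ?J = "{pred_index j, j}"
  have card: "card ?I = 2" "card ?J = 2" using ij by auto
  then have "tropically_nonneg 2 (submatrix_of A ?I ?J)"
    using assms(1) unfolding TN_trop_def by (metis (mono_tags, lifting) insert_not_empty mem_Collect_eq)
  from tropically_nonneg_2[OF this] show ?thesis
    using ij ij[THEN less_imp_le] by (simp add: submatrix_of_def p mixed_diff_def)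
qed

text \<open>
  The consecutive \<open>2 \<times> 2\<close> minors already force a matrix into \<open>V + S\<close>, and every matrix there has
  all its minors nonnegative.
\<close>

lemma TN_trop_eq: "TN_trop = row_col_sums + staircase_matrices"
proof
  show "TN_trop \<subseteq> row_col_sums + staircase_matrices"
    using mixed_diff_nonneg_if_TN
    by (auto simp: staircase.kernel_plus_gen_cone
          simp flip: kernel_eq_row_col_sums gen_cone_eq_staircase_matrices)
qed (rule row_col_sums_plus_staircase_subset_TN)

theorem corollary4p8:
  shows "let TN = (TN_trop :: (real^'m::{finite,linorder}^'n::{finite,linorder}) set);
             V = (row_col_sums :: (real^'m::_^'n::_) set);
             S = (staircase_matrices :: (real^'m::_^'n::_) set)
         in polyhedron TN \<and>
            TN = V + S \<and>
            V = lineality_space TN \<and>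
            subspace V \<and> dim V = CARD('n) + CARD('m) - 1 \<and>
            simplicial_cone S \<and>
            aff_dim S = int ((CARD('n) - 1) * (CARD('m) - 1)) \<and>
            extreme_rays S = (\<lambda>p. conic hull {elem_staircase p}) ` staircase_idx"
proof -
  let ?V = "row_col_sums :: (real^'m::_^'n::_) set"
  note translate = kernel_eq_row_col_sums gen_cone_eq_staircase_matrices card_staircase_idx
  note shape =
    staircase.polyhedron_kernel_plus_gen_cone[where 'n = 'n and 'm = 'm, unfolded translate]
    staircase.lineality_space_kernel_plus_gen_cone[where 'n = 'n and 'm = 'm, unfolded translate, symmetric]
    staircase.subspace_kernel[where 'n = 'n and 'm = 'm, unfolded translate]
  note cone =
    staircase.simplicial_cone_gen_cone[where 'n = 'n and 'm = 'm, unfolded translate]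
    staircase.aff_dim_gen_cone[where 'n = 'n and 'm = 'm, unfolded translate]
    staircase.extreme_rays_gen_cone[where 'n = 'n and 'm = 'm, unfolded translate]
  have codim: "dim ?V + (CARD('n) - 1) * (CARD('m) - 1) = CARD('n) * CARD('m)"
    using staircase.dim_kernel[where 'n = 'n and 'm = 'm, unfolded translate]
    by (simp only: DIM_cart DIM_real mult_1_right)
  have arith: "(a - 1) * (b - 1) + (a + b - 1) = a * b" if "0 < a" "0 < b" for a b :: nat
    using that by (cases a; cases b) auto
  have dim: "dim ?V = CARD('n) + CARD('m) - 1"
    using codim arith[of "CARD('n)" "CARD('m)"] zero_less_card_finite[where 'a = 'n]
      zero_less_card_finite[where 'a = 'm] by linarith
  show ?thesis
    unfolding Let_def
    by (intro conjI shape[folded TN_trop_eq] TN_trop_eq dim cone)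
qed

end
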